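(* Let $K\ge2$, let $(\Omega,\mathcal{A})$ be a measurable space, let $\mathfrak{P}(\Omega)$ be the set of all probability measures on it, let $H_1,\dots,H_K\subseteq\mathfrak{P}(\Omega)$ be composite null hypotheses, and for each $k\in\{1,\dots,K\}$ let $E_k:\Omega\to[0,\infty]$ be an e-variable with respect to $H_k$. (1) Let $E^*_1,\dots,E^*_K$ be the extended random variables obtained by applying Algorithm 1 pointwise to the values of $E_1,\dots,E_K$. Then $E^*_1,\dots,E^*_K$ are family-wise valid for testing $H_1,\dots,H_K$. (2) Suppose that, for every $Q\in\mathfrak{P}(\Omega)$, the e-variables $E_k$, $k\in I_Q:=\{k\in\{1,\dots,K\}: Q\in H_k\}$, are sequential under $Q$. Let $E^*_1,\dots,E^*_K$ be the extended random variables obtained by applying Algorithm 2 pointwise to the values of $E_1,\dots,E_K$. Then $E^*_1,\dots,E^*_K$ are family-wise valid for testing $H_1,\dots,H_K$.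
   Context: A measurable $E:\Omega\to[0,\infty]$ is an e-variable with respect to $H\subseteq\mathfrak{P}(\Omega)$ if $\mathbb{E}^Q[E]\le1$ for all $Q\in H$. A conditional e-variable is a family $(E_Q)_{Q\in\mathfrak{P}(\Omega)}$ of measurable functions $E_Q:\Omega\to[0,\infty]$ such that $\mathbb{E}^Q[E_Q]\le1$ for every $Q\in\mathfrak{P}(\Omega)$. Extended random variables $E^*_1,\dots,E^*_K$ with values in $[0,\infty]$ are family-wise valid for testing $H_1,\dots,H_K$ if there exists a conditional e-variable $(E_Q)_{Q\in\mathfrak{P}(\Omega)}$ such that for all $k\in\{1,\dots,K\}$ and all $Q\in H_k$, $E_Q(\omega)\ge E^*_k(\omega)$ for all $\omega\in\Omega$. E-variables $E_k$, $k\in I$ (with $I\subseteq\{1,\dots,K\}$), are sequential under $Q$ if, for every $k\in I$, $\mathbb{E}^Q[E_k\mid E_j,\ j\in I,\ j<k]\le1$ $Q$-almost surely. Algorithm 1 (input $e_1,\dots,e_K\in[0,\infty]$): choose a permutation $\pi$ of $\{1,\dots,K\}$ with $e_{\pi(1)}\le\dots\le e_{\pi(K)}$; set $S_0:=0$ and $S_i:=e_{\pi(1)}+\dots+e_{\pi(i)}$; output, for $k=1,\dots,K$, $$e^*_{\pi(k)}:=\min_{i\in\{0,\dots,k-1\}}\frac{e_{\pi(k)}+S_i}{i+1}.$$ Algorithm 2 (input $e_1,\dots,e_K\in[0,\infty]$): let $a$ be the product of all those $e_k$, $k\in\{1,\dots,K\}$, with $e_k<1$ ($a:=1$ if there are none);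 output $e^*_k:=a\,e_k$ for $k=1,\dots,K$. Convention: $0\cdot\infty=0$. *)

theory Defs
  imports "HOL-Probability.Probability" "HOL-Combinatorics.Permutations"
begin

definition prob_measures :: "'a measure \<Rightarrow> 'a measure set" where
  "prob_measures M = {Q. prob_space Q \<and> sets Q = sets M}"

definition e_variable :: "'a measure \<Rightarrow> 'a measure set \<Rightarrow> ('a \<Rightarrow> ennreal) \<Rightarrow> bool" where
  "e_variable M H X \<longleftrightarrow>
     X \<in> borel_measurable M \<and> (\<forall>Q\<in>H. (\<integral>\<^sup>+\<omega>. X \<omega> \<partial>Q) \<le> 1)"

definition conditional_e_variable :: "'a measure \<Rightarrow> ('a measure \<Rightarrow> 'a \<Rightarrow> ennreal) \<Rightarrow> bool" where
  "conditional_e_variable M F \<longleftrightarrow>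
     (\<forall>Q\<in>prob_measures M. F Q \<in> borel_measurable M \<and> (\<integral>\<^sup>+\<omega>. F Q \<omega> \<partial>Q) \<le> 1)"

text \<open>The first conjunct is part of being an extended random variable.\<close>

definition family_wise_valid ::
    "'a measure \<Rightarrow> nat \<Rightarrow> (nat \<Rightarrow> 'a measure set) \<Rightarrow> (nat \<Rightarrow> 'a \<Rightarrow> ennreal) \<Rightarrow> bool" where
  "family_wise_valid M K H X \<longleftrightarrow>
     (\<forall>k\<in>{1..K}. X k \<in> borel_measurable M) \<and>
     (\<exists>F. conditional_e_variable M F \<and>
        (\<forall>k\<in>{1..K}. \<forall>Q\<in>H k. \<forall>\<omega>\<in>space M. F Q \<omega> \<ge> X k \<omega>))"

definition generated_sigma :: "'a measure \<Rightarrow> nat set \<Rightarrow> (nat \<Rightarrow> 'a \<Rightarrow> ennreal) \<Rightarrow> 'a measure" where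
  "generated_sigma M J X =
     sigma (space M) (\<Union>j\<in>J. {X j -` B \<inter> space M | B. B \<in> sets borel})"

text \<open>
  The measurability conjunct guards against the default value 0 that \<^const>\<open>nn_cond_exp\<close>
  takes on non-measurable functions.
\<close>

definition sequential_under :: "'a measure \<Rightarrow> nat set \<Rightarrow> (nat \<Rightarrow> 'a \<Rightarrow> ennreal) \<Rightarrow> bool" where
  "sequential_under Q I X \<longleftrightarrow>
     (\<forall>k\<in>I. X k \<in> borel_measurable Q) \<and>
     (\<forall>k\<in>I. AE \<omega> in Q. nn_cond_exp Q (generated_sigma Q {j\<in>I. j < k} X) (X k) \<omega> \<le> 1)"

text \<open>
  Algorithm 1 as a relation between inputs and outputs, since the sorting permutation
  need not be unique when there are ties.
\<close>

definition algorithm1_output :: "nat \<Rightarrow> (nat \<Rightarrow> ennreal) \<Rightarrow> (nat \<Rightarrow> ennreal) \<Rightarrow> bool" where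
  "algorithm1_output K e e' \<longleftrightarrow>
     (\<exists>\<pi>. \<pi> permutes {1..K} \<and>
          (\<forall>i\<in>{1..K}. \<forall>j\<in>{1..K}. i \<le> j \<longrightarrow> e (\<pi> i) \<le> e (\<pi> j)) \<and>
          (\<forall>k\<in>{1..K}.
             e' (\<pi> k) = (MIN i\<in>{..<k}. (e (\<pi> k) + (\<Sum>j=1..i. e (\<pi> j))) / of_nat (i + 1))))"

lemma algorithm1_output_exists: "\<exists>e'. algorithm1_output K e e'"
proof -
  define xs where "xs = sort_key e [1..<Suc K]"
  have len: "length xs = K" and dist: "distinct xs" and set: "set xs = {1..K}"
    and sorted: "sorted (map e xs)"
    by (auto simp: xs_def)
  define \<pi> where "\<pi> i = (if i \<in> {1..K} then xs ! (i - 1) else i)" for i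
  have "bij_betw (\<lambda>i. xs ! (i - 1)) {1..K} {1..K}"
  proof -
    have "bij_betw (\<lambda>i::nat. i - 1) {1..K} {..<K}"
      by (rule bij_betw_byWitness[where f' = Suc]) auto
    moreover have "bij_betw ((!) xs) {..<K} {1..K}"
      using bij_betw_nth[OF dist] len set by auto
    ultimately show ?thesis
      using bij_betw_trans by (fastforce simp: o_def)
  qed
  then have "bij_betw \<pi> {1..K} {1..K}"
    by (rule bij_betw_cong[THEN iffD1, rotated]) (auto simp: \<pi>_def)
  then have perm: "\<pi> permutes {1..K}"
    by (rule bij_imp_permutes) (auto simp: \<pi>_def)
  have mono: "e (\<pi> i) \<le> e (\<pi> j)" if "i \<in> {1..K}" "j \<in> {1..K}" "i \<le> j" for i j
    using that sorted_nth_mono[OF sorted, of "i - 1" "j - 1"] len by (auto simp: \<pi>_def)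
  define e' where "e' l = (let k = inv \<pi> l in
    MIN i\<in>{..<k}. (e (\<pi> k) + (\<Sum>j=1..i. e (\<pi> j))) / of_nat (i + 1))" for l
  have "algorithm1_output K e e'"
    unfolding algorithm1_output_def
    using perm mono by (intro exI[of _ \<pi>]) (auto simp: e'_def permutes_inverses[OF perm])
  then show ?thesis by blast
qed

definition algorithm2 :: "nat \<Rightarrow> (nat \<Rightarrow> ennreal) \<Rightarrow> nat \<Rightarrow> ennreal" where
  "algorithm2 K e k = (\<Prod>j\<in>{j\<in>{1..K}. e j < 1}. e j) * e k"

end

theory Submission
  imports Defs
begin

text \<open>
  Both parts are instances of the closure principle. For a probability measure \<open>Q\<close> let \<open>I\<^sub>Q\<close> be
  the set of indices of the null hypotheses that contain \<open>Q\<close>. The e-variables with index in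
  \<open>I\<^sub>Q\<close> are merged into a single function that still has expectation at most one under \<open>Q\<close>,
  and the adjusted e-values lie pointwise below the merged function, whatever the set \<open>I\<^sub>Q\<close> is.

  For the first algorithm the merging function is the arithmetic mean, for which no dependence
  assumption is needed. The adjusted value with index \<open>k\<close> is exactly the smallest mean over all
  index sets that contain \<open>k\<close> (\<open>algorithm1_output_eq_Min_mean\<close>): for a given number of further
  members the mean is smallest when these are the smallest values, and members above the
  value with index \<open>k\<close> do not help to lower it. This formula does not mention the sorting
  permutation, so it also shows that the adjusted values are measurable, although the permutation
  may be chosen separately at each point.

  For the second algorithm the merging function is the product. Its expectation is at most one by
  conditioning on the earlier factors, one factor after the other
  (\<open>nn_integral_prod_sequential_le_1\<close>). The adjusted value is a lower bound of the
  product because leaving out factors that are at least one, and adding factors below one, can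
  only lower a product (\<open>algorithm2_le_prod\<close>).
\<close>

section \<open>Adjusted values as smallest means\<close>

text \<open>
  The \<open>i\<close>-th smallest member of \<open>A\<close> is at least \<open>i\<close>, because \<open>A\<close> consists of positive numbers,
  so its value dominates \<open>f i\<close>.
\<close>

lemma sum_initial_le_sum:
  fixes f :: "nat \<Rightarrow> 'b::ordered_comm_monoid_add"
  assumes "A \<subseteq> {1..n}" and "mono_on {1..n} f"
  shows "(\<Sum>j=1..card A. f j) \<le> (\<Sum>j\<in>A. f j)"
  using assms
proof (induction n arbitrary: A)
  case 0
  then show ?case by auto
next
  case (Suc n)
  have mono: "mono_on {1..n} f"
    using Suc.prems(2) by (rule mono_on_subset) auto
  have fin: "finite A"
    using Suc.prems(1) finite_subset by blast
  show ?case
  proof (cases "Suc n \<in> A")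
    case False
    then have "A \<subseteq> {1..n}"
      using Suc.prems(1) by (auto simp: le_Suc_eq)
    then show ?thesis using Suc.IH mono by blast
  next
    case True
    define B where "B = A - {Suc n}"
    have B: "B \<subseteq> {1..n}"
      using Suc.prems(1) by (auto simp: B_def le_Suc_eq)
    have A: "A = insert (Suc n) B" "Suc n \<notin> B" "finite B"
      using True fin by (auto simp: B_def)
    have "card B \<le> n"
      using card_mono[OF _ B] by simp
    then have "f (Suc (card B)) \<le> f (Suc n)"
      by (intro mono_onD[OF Suc.prems(2)]) auto
    moreover have "(\<Sum>j=1..card B. f j) \<le> (\<Sum>j\<in>B. f j)"
      using Suc.IH[OF B mono] .
    ultimately have "f (Suc (card B)) + (\<Sum>j=1..card B. f j) \<le> f (Suc n) + (\<Sum>j\<in>B. f j)"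
      by (rule add_mono)
    then show ?thesis
      using A by (simp add: add.commute)
  qed
qed

text \<open>
  Adding to a family of values bounded by \<open>c\<close> further values above \<open>c\<close> cannot lower the mean.
  The statement is the inequality of the means with the denominators cleared.
\<close>

lemma sum_union_mult_card_ge:
  fixes f :: "'i \<Rightarrow> ennreal"
  assumes "finite A" "finite B" "A \<inter> B = {}"
    and lo: "\<And>x. x \<in> A \<Longrightarrow> f x \<le> c" and hi: "\<And>x. x \<in> B \<Longrightarrow> c \<le> f x"
  shows "sum f A * of_nat (card (A \<union> B)) \<le> sum f (A \<union> B) * of_nat (card A)"
proof -
  have "sum f A \<le> of_nat (card A) * c"
    using sum_bounded_above[of A f c] lo by auto
  then have "sum f A * of_nat (card B) \<le> (of_nat (card A) * c) * of_nat (card B)"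
    by (rule mult_right_mono) simp
  also have "\<dots> = (of_nat (card B) * c) * of_nat (card A)"
    by (simp only: ac_simps)
  also have "\<dots> \<le> sum f B * of_nat (card A)"
    using sum_bounded_below[of B c f] hi by (intro mult_right_mono) auto
  finally have "sum f A * of_nat (card B) \<le> sum f B * of_nat (card A)" .
  then show ?thesis
    using assms(1-3)
    by (simp add: card_Un_disjoint sum.union_disjoint distrib_left distrib_right add_left_mono)
qed

lemma ennreal_divide_le_divide_of_nat:
  fixes a b :: ennreal
  assumes "a * of_nat n \<le> b * of_nat m" "m > 0" "n > 0"
  shows "a / of_nat m \<le> b / of_nat n"
proof -
  have "a = (a * of_nat n) / of_nat n"
    using assms by (simp add: ennreal_mult_divide_eq)
  also have "\<dots> \<le> (b * of_nat m) / of_nat n"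
    using assms(1) by (rule divide_right_mono_ennreal)
  also have "\<dots> = (b / of_nat n) * of_nat m"
    by (simp only: ennreal_divide_times ennreal_times_divide)
  finally have "a / of_nat m \<le> (b / of_nat n) * of_nat m / of_nat m"
    by (rule divide_right_mono_ennreal)
  also have "\<dots> = b / of_nat n"
    using assms by (simp add: ennreal_mult_divide_eq)
  finally show ?thesis .
qed

text \<open>
  The left-hand mean runs over \<open>{1..i} \<union> {m}\<close>, where \<open>i\<close> is the number of members of \<open>J\<close>
  below \<open>m\<close>. Such a set arises from \<open>J\<close> by dropping the members above \<open>m\<close>, whose values are
  at least those kept, and by moving the members below \<open>m\<close> down to the first \<open>i\<close> positions.
  Neither step raises the mean.
\<close>

lemma ex_initial_mean_le_mean:
  fixes f :: "nat \<Rightarrow> ennreal"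
  assumes mono: "mono_on {1..K} f" and J: "J \<subseteq> {1..K}" and m: "m \<in> J"
  shows "\<exists>i<m. (f m + (\<Sum>j=1..i. f j)) / of_nat (i + 1) \<le> sum f J / of_nat (card J)"
proof -
  define A where "A = {j\<in>J. j < m}"
  define B where "B = {j\<in>J. m < j}"
  define i where "i = card A"
  have fin: "finite J" using J finite_subset by blast
  have fAB: "finite A" "finite B" using fin by (auto simp: A_def B_def)
  have A_sub: "A \<subseteq> {1..m - 1}"
    using J by (auto simp: A_def)
  have "i < m"
    using card_mono[OF _ A_sub] m J unfolding i_def by fastforce
  have cA: "card (insert m A) = i + 1"
    using fAB by (simp add: i_def A_def)
  have J_eq: "J = insert m A \<union> B"
    using m by (auto simp: A_def B_def)
  have "mono_on {1..m - 1} f"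
    using mono m J by (intro mono_on_subset[OF mono]) fastforce
  then have "f m + (\<Sum>j=1..i. f j) \<le> f m + sum f A"
    unfolding i_def by (intro add_left_mono sum_initial_le_sum[OF A_sub])
  also have "\<dots> = sum f (insert m A)"
    using fAB by (simp add: A_def)
  finally have "(f m + (\<Sum>j=1..i. f j)) / of_nat (i + 1)
      \<le> sum f (insert m A) / of_nat (card (insert m A))"
    unfolding cA by (rule divide_right_mono_ennreal)
  also have "\<dots> \<le> sum f J / of_nat (card J)"
  proof (rule ennreal_divide_le_divide_of_nat)
    show "sum f (insert m A) * of_nat (card J) \<le> sum f J * of_nat (card (insert m A))"
      unfolding J_eq
    proof (rule sum_union_mult_card_ge)
      show "f x \<le> f m" if "x \<in> insert m A" for x
        using that m J by (intro mono_onD[OF mono]) (auto simp: A_def)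
      show "f m \<le> f x" if "x \<in> B" for x
        using that m J by (intro mono_onD[OF mono]) (auto simp: B_def)
    qed (use fAB in \<open>auto simp: A_def B_def\<close>)
  qed (use fin m cA in \<open>auto simp: card_gt_0_iff\<close>)
  finally show ?thesis using \<open>i < m\<close> by blast
qed

text \<open>
  The minimum that defines the algorithm runs over linearly many index sets in the sorted order,
  but it equals the minimum over all sets that contain the given index.
\<close>

lemma algorithm1_output_eq_Min_mean:
  assumes alg: "algorithm1_output K e e'" and l: "l \<in> {1..K}"
  shows "e' l = (MIN J\<in>{J. J \<subseteq> {1..K} \<and> l \<in> J}. sum e J / of_nat (card J))"
    (is "_ = Min (?g ` ?S)")
proof -
  obtain \<pi> where perm: "\<pi> permutes {1..K}"
    and sorted: "\<forall>i\<in>{1..K}. \<forall>j\<in>{1..K}. i \<le> j \<longrightarrow> e (\<pi> i) \<le> e (\<pi> j)"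
    and out: "\<forall>k\<in>{1..K}. e' (\<pi> k) =
        (MIN i\<in>{..<k}. (e (\<pi> k) + (\<Sum>j=1..i. e (\<pi> j))) / of_nat (i + 1))"
    using alg unfolding algorithm1_output_def by blast
  define m where "m = inv \<pi> l"
  have l_eq: "l = \<pi> m"
    using permutes_inverses[OF perm] by (simp add: m_def)
  have m: "m \<in> {1..K}"
    using l permutes_in_image[OF perm] by (simp add: l_eq)
  have inj: "inj_on \<pi> A" for A
    using permutes_inj[OF perm] by (rule inj_on_subset) auto
  define h where "h i = (e (\<pi> m) + (\<Sum>j=1..i. e (\<pi> j))) / of_nat (i + 1)" for i
  have e'_l: "e' l = Min (h ` {..<m})"
    using out m by (auto simp: l_eq h_def)
  have "0 \<in> {..<m}" using m by simp
  then have ne: "h ` {..<m} \<noteq> {}" by blast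
  have "finite ?S" by (rule finite_subset[of _ "Pow {1..K}"]) auto
  moreover have "?S \<noteq> {}" using l by blast
  ultimately have fin: "finite (?g ` ?S)" "?g ` ?S \<noteq> {}" by simp_all
  show ?thesis unfolding e'_l
  proof (rule antisym)
    have "Min (h ` {..<m}) \<le> ?g J" if J: "J \<in> ?S" for J
    proof -
      have J_img: "\<pi> ` (\<pi> -` J) = J"
        using permutes_surj[OF perm] by (simp add: surj_image_vimage_eq)
      have "\<exists>i<m. h i \<le> (\<Sum>j\<in>\<pi> -` J. e (\<pi> j)) / of_nat (card (\<pi> -` J))"
        unfolding h_def
      proof (rule ex_initial_mean_le_mean)
        show "mono_on {1..K} (\<lambda>j. e (\<pi> j))"
          using sorted by (auto intro!: mono_onI)
        show "\<pi> -` J \<subseteq> {1..K}"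
        proof
          fix x assume "x \<in> \<pi> -` J"
          then have "\<pi> x \<in> {1..K}" using J by blast
          then show "x \<in> {1..K}" by (simp only: permutes_in_image[OF perm])
        qed
        show "m \<in> \<pi> -` J" using J by (simp add: l_eq)
      qed
      moreover have "(\<Sum>j\<in>\<pi> -` J. e (\<pi> j)) = sum e J"
        using sum.reindex[OF inj, of e "\<pi> -` J"] J_img by (simp add: o_def)
      moreover have "card (\<pi> -` J) = card J"
        using card_image[OF inj, of "\<pi> -` J"] J_img by simp
      ultimately obtain i where "i < m" "h i \<le> ?g J" by auto
      then show ?thesis by (intro Min_le_iff[THEN iffD2] ne) auto
    qed
    then show "Min (h ` {..<m}) \<le> Min (?g ` ?S)"
      using fin by (intro Min.boundedI) auto
  next
    have "Min (?g ` ?S) \<le> h i" if i: "i < m" for i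
    proof -
      define J where "J = \<pi> ` insert m {1..i}"
      have "insert m {1..i} \<subseteq> {1..K}"
        using m i by auto
      then have "J \<subseteq> {1..K}"
        unfolding J_def by (subst permutes_image[OF perm, symmetric]) (rule image_mono)
      then have "J \<in> ?S"
        by (simp add: J_def l_eq)
      then have "Min (?g ` ?S) \<le> ?g J"
        using fin(1) by (intro Min_le imageI)
      also have "?g J = h i"
        using i unfolding J_def h_def
        by (subst sum.reindex[OF inj], subst card_image[OF inj]) (simp add: o_def)
      finally show ?thesis .
    qed
    then show "Min (?g ` ?S) \<le> Min (h ` {..<m})"
      using ne by (intro Min.boundedI) auto
  qed
qed

lemma borel_measurable_Min_image:
  fixes f :: "'i \<Rightarrow> 'a \<Rightarrow> ennreal"
  assumes "finite S" "S \<noteq> {}" "\<And>i. i \<in> S \<Longrightarrow> f i \<in> borel_measurable M"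
  shows "(\<lambda>\<omega>. MIN i\<in>S. f i \<omega>) \<in> borel_measurable M"
proof -
  have "(\<lambda>\<omega>. MIN i\<in>S. f i \<omega>) = (\<lambda>\<omega>. INF i\<in>S. f i \<omega>)"
    using assms(1,2) by (simp add: Min_Inf)
  then show ?thesis
    using assms by (simp add: countable_finite)
qed

lemma nn_integral_mean_le_1:
  fixes X :: "'i \<Rightarrow> 'a \<Rightarrow> ennreal"
  assumes "\<And>i. i \<in> I \<Longrightarrow> X i \<in> borel_measurable Q"
    and "\<And>i. i \<in> I \<Longrightarrow> (\<integral>\<^sup>+\<omega>. X i \<omega> \<partial>Q) \<le> 1"
  shows "(\<integral>\<^sup>+\<omega>. (\<Sum>i\<in>I. X i \<omega>) / of_nat (card I) \<partial>Q) \<le> 1"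
proof -
  have "(\<integral>\<^sup>+\<omega>. (\<Sum>i\<in>I. X i \<omega>) / of_nat (card I) \<partial>Q)
      = (\<Sum>i\<in>I. \<integral>\<^sup>+\<omega>. X i \<omega> \<partial>Q) / of_nat (card I)"
    using assms(1) by (simp add: nn_integral_divide nn_integral_sum)
  also have "\<dots> \<le> of_nat (card I) / of_nat (card I)"
    using sum_bounded_above[of I "\<lambda>i. \<integral>\<^sup>+\<omega>. X i \<omega> \<partial>Q" 1] assms(2)
    by (intro divide_right_mono_ennreal) auto
  also have "\<dots> \<le> (1::ennreal)"
    by (cases "card I = 0") (auto simp: ennreal_divide_self of_nat_less_top)
  finally show ?thesis .
qed

section \<open>Products of sequential e-variables\<close>

lemma measurable_generated_sigma:
  assumes "j \<in> J"
  shows "X j \<in> borel_measurable (generated_sigma M J X)"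
proof (rule measurableI)
  let ?\<G> = "\<Union>j\<in>J. {X j -` B \<inter> space M | B. B \<in> sets borel}"
  fix B :: "ennreal set" assume "B \<in> sets borel"
  then have "X j -` B \<inter> space M \<in> ?\<G>"
    using assms by blast
  moreover have "?\<G> \<subseteq> Pow (space M)" by blast
  ultimately show "X j -` B \<inter> space (generated_sigma M J X) \<in> sets (generated_sigma M J X)"
    by (simp only: generated_sigma_def space_measure_of sets_measure_of sigma_sets.Basic)
qed simp

lemma subalgebra_generated_sigma:
  assumes "\<And>j. j \<in> J \<Longrightarrow> X j \<in> borel_measurable M"
  shows "subalgebra M (generated_sigma M J X)"
proof -
  have gen: "(\<Union>j\<in>J. {X j -` B \<inter> space M | B. B \<in> sets borel}) \<subseteq> sets M"
    using assms by (auto intro: measurable_sets)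
  then have "(\<Union>j\<in>J. {X j -` B \<inter> space M | B. B \<in> sets borel}) \<subseteq> Pow (space M)"
    using sets.sets_into_space by blast
  then show ?thesis
    using sets.sigma_sets_subset[OF gen]
    by (simp add: subalgebra_def generated_sigma_def sets_measure_of space_measure_of)
qed

text \<open>
  The earlier factors are measurable with respect to the \<open>\<sigma>\<close>-algebra on which the last one is
  conditioned, so they can be pulled out of the conditional expectation, which is at most one.
\<close>

lemma nn_integral_prod_sequential_le_1:
  assumes Q: "prob_space Q" and "finite I" and seq: "sequential_under Q I X"
  shows "(\<integral>\<^sup>+\<omega>. (\<Prod>j\<in>I. X j \<omega>) \<partial>Q) \<le> 1"
proof -
  interpret prob_space Q by fact
  have meas: "X j \<in> borel_measurable Q" if "j \<in> I" for j
    using seq that by (simp add: sequential_under_def)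
  have "(\<integral>\<^sup>+\<omega>. (\<Prod>j\<in>{j\<in>I. j < n}. X j \<omega>) \<partial>Q) \<le> 1" for n
  proof (induction n)
    case 0
    then show ?case by (simp add: emeasure_space_1)
  next
    case (Suc n)
    let ?J = "{j\<in>I. j < n}"
    let ?P = "\<lambda>\<omega>. \<Prod>j\<in>?J. X j \<omega>"
    let ?G = "generated_sigma Q ?J X"
    show ?case
    proof (cases "n \<in> I")
      case False
      then have "{j\<in>I. j < Suc n} = ?J" by (auto simp: less_Suc_eq)
      then show ?thesis using Suc.IH by simp
    next
      case True
      have "subalgebra Q ?G"
        using meas by (intro subalgebra_generated_sigma) auto
      then interpret finite_measure_subalgebra Q ?G
        by unfold_locales
      have P: "?P \<in> borel_measurable ?G"
        by (intro borel_measurable_prod_ennreal measurable_generated_sigma)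
      have "{j\<in>I. j < Suc n} = insert n ?J"
        using True by (auto simp: less_Suc_eq)
      then have "(\<integral>\<^sup>+\<omega>. (\<Prod>j\<in>{j\<in>I. j < Suc n}. X j \<omega>) \<partial>Q) = (\<integral>\<^sup>+\<omega>. ?P \<omega> * X n \<omega> \<partial>Q)"
        using \<open>finite I\<close> by (simp add: mult.commute)
      also have "\<dots> = (\<integral>\<^sup>+\<omega>. ?P \<omega> * nn_cond_exp Q ?G (X n) \<omega> \<partial>Q)"
        using nn_cond_exp_intg[OF P meas[OF True]] by simp
      also have "\<dots> \<le> (\<integral>\<^sup>+\<omega>. ?P \<omega> \<partial>Q)"
      proof (rule nn_integral_mono_AE)
        have "AE \<omega> in Q. nn_cond_exp Q ?G (X n) \<omega> \<le> 1"
          using seq True by (simp add: sequential_under_def)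
        then show "AE \<omega> in Q. ?P \<omega> * nn_cond_exp Q ?G (X n) \<omega> \<le> ?P \<omega>"
        proof eventually_elim
          case (elim \<omega>)
          then show ?case
            using mult_left_mono[OF elim, of "?P \<omega>"] by simp
        qed
      qed
      also have "\<dots> \<le> 1" by (rule Suc.IH)
      finally show ?thesis .
    qed
  qed
  moreover have "{j\<in>I. j < Suc (Max I)} = I"
    using \<open>finite I\<close> by (auto simp: less_Suc_eq_le)
  ultimately show ?thesis by metis
qed

text \<open>
  Truncation at one makes the index set of the product independent of the values, so that
  measurability in the values is evident.
\<close>

lemma algorithm2_eq_prod_min:
  "algorithm2 K e k = (\<Prod>j=1..K. min 1 (e j)) * e k"
proof -
  have "(\<Prod>j\<in>{j\<in>{1..K}. e j < 1}. e j) = (\<Prod>j=1..K. if e j < 1 then e j else 1)"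
    by (rule prod.inter_filter) simp
  also have "\<dots> = (\<Prod>j=1..K. min 1 (e j))"
    by (intro prod.cong) auto
  finally show ?thesis by (simp add: algorithm2_def)
qed

text \<open>
  Inside \<open>I\<close> each truncated factor is at most the factor itself, outside at most one. The factor
  with index \<open>k\<close> is accounted for by \<open>e k\<close> itself, and its truncation is dropped.
\<close>

lemma algorithm2_le_prod:
  assumes "I \<subseteq> {1..K}" "k \<in> I"
  shows "algorithm2 K e k \<le> (\<Prod>j\<in>I. e j)"
proof -
  have fin: "finite I" using assms finite_subset by blast
  have "(\<Prod>j=1..K. min 1 (e j)) = (\<Prod>j\<in>{1..K} - (I - {k}). min 1 (e j)) * (\<Prod>j\<in>I - {k}. min 1 (e j))"
    using assms by (intro prod.subset_diff) auto
  also have "\<dots> \<le> 1 * (\<Prod>j\<in>I - {k}. e j)"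
    by (intro mult_mono prod_le_1 prod_mono_ennreal) auto
  finally have "algorithm2 K e k \<le> (\<Prod>j\<in>I - {k}. e j) * e k"
    unfolding algorithm2_eq_prod_min by (intro mult_right_mono) auto
  also have "\<dots> = (\<Prod>j\<in>I. e j)"
    using fin assms by (simp add: prod.remove mult.commute)
  finally show ?thesis .
qed

section \<open>Family-wise validity\<close>

theorem theorem5p1:
  fixes M :: "'a measure" and K :: nat
    and H :: "nat \<Rightarrow> 'a measure set" and E :: "nat \<Rightarrow> 'a \<Rightarrow> ennreal"
  assumes "K \<ge> 2"
    and "\<And>k. k \<in> {1..K} \<Longrightarrow> H k \<subseteq> prob_measures M"
    and "\<And>k. k \<in> {1..K} \<Longrightarrow> e_variable M (H k) (E k)"
  shows "(\<forall>Estar. (\<forall>\<omega>\<in>space M. algorithm1_output K (\<lambda>k. E k \<omega>) (\<lambda>k. Estar k \<omega>)) \<longrightarrow>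
            family_wise_valid M K H Estar) \<and>
         ((\<forall>Q\<in>prob_measures M. sequential_under Q {k\<in>{1..K}. Q \<in> H k} E) \<longrightarrow>
            family_wise_valid M K H (\<lambda>k \<omega>. algorithm2 K (\<lambda>j. E j \<omega>) k))"
proof (intro conjI allI impI)
  define I where "I Q = {k\<in>{1..K}. Q \<in> H k}" for Q
  have I_sub: "I Q \<subseteq> {1..K}" for Q by (auto simp: I_def)
  have E_meas: "E k \<in> borel_measurable M" if "k \<in> {1..K}" for k
    using assms(3)[OF that] by (simp add: e_variable_def)
  have sets_Q: "sets Q = sets M" if "Q \<in> prob_measures M" for Q
    using that by (simp add: prob_measures_def)
  have E_int: "(\<integral>\<^sup>+\<omega>. E k \<omega> \<partial>Q) \<le> 1" if "k \<in> I Q" for k Q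
    using assms(3)[of k] that by (auto simp: e_variable_def I_def)

  show "family_wise_valid M K H Estar"
    if alg: "\<forall>\<omega>\<in>space M. algorithm1_output K (\<lambda>k. E k \<omega>) (\<lambda>k. Estar k \<omega>)" for Estar
  proof -
    let ?S = "\<lambda>k. {J. J \<subseteq> {1..K} \<and> k \<in> J}"
    let ?F = "\<lambda>Q \<omega>. (\<Sum>j\<in>I Q. E j \<omega>) / of_nat (card (I Q))"
    have fin: "finite (?S k)" for k
      by (rule finite_subset[of _ "Pow {1..K}"]) auto
    have eq: "Estar k \<omega> = (MIN J\<in>?S k. (\<Sum>j\<in>J. E j \<omega>) / of_nat (card J))"
      if "k \<in> {1..K}" "\<omega> \<in> space M" for k \<omega>
      using algorithm1_output_eq_Min_mean[OF bspec[OF alg that(2)] that(1)] by simp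
    have "Estar k \<in> borel_measurable M" if k: "k \<in> {1..K}" for k
    proof (subst measurable_cong[OF eq[OF k]])
      show "(\<lambda>\<omega>. MIN J\<in>?S k. (\<Sum>j\<in>J. E j \<omega>) / of_nat (card J)) \<in> borel_measurable M"
        using k fin E_meas
        by (intro borel_measurable_Min_image borel_measurable_divide_ennreal borel_measurable_sum) auto
    qed
    moreover have "conditional_e_variable M ?F"
      unfolding conditional_e_variable_def
    proof (intro ballI conjI)
      fix Q assume Q: "Q \<in> prob_measures M"
      show "?F Q \<in> borel_measurable M"
        using E_meas I_sub[of Q]
        by (intro borel_measurable_divide_ennreal borel_measurable_sum) auto
      show "(\<integral>\<^sup>+\<omega>. ?F Q \<omega> \<partial>Q) \<le> 1"
        using E_meas E_int I_sub[of Q]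
        by (intro nn_integral_mean_le_1) (auto simp: measurable_cong_sets[OF sets_Q[OF Q] refl])
    qed
    moreover have "Estar k \<omega> \<le> ?F Q \<omega>" if "k \<in> {1..K}" "Q \<in> H k" "\<omega> \<in> space M" for k Q \<omega>
    proof -
      have "I Q \<in> ?S k" using that by (auto simp: I_def)
      then show ?thesis
        unfolding eq[OF that(1,3)] using fin by (intro Min_le) auto
    qed
    ultimately show ?thesis
      unfolding family_wise_valid_def by blast
  qed

  show "family_wise_valid M K H (\<lambda>k \<omega>. algorithm2 K (\<lambda>j. E j \<omega>) k)"
    if seq: "\<forall>Q\<in>prob_measures M. sequential_under Q {k\<in>{1..K}. Q \<in> H k} E"
  proof -
    let ?F = "\<lambda>Q \<omega>. \<Prod>j\<in>I Q. E j \<omega>"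
    have "(\<lambda>\<omega>. algorithm2 K (\<lambda>j. E j \<omega>) k) \<in> borel_measurable M" if "k \<in> {1..K}" for k
      unfolding algorithm2_eq_prod_min
      using E_meas that
      by (intro borel_measurable_times_ennreal borel_measurable_prod_ennreal borel_measurable_min) auto
    moreover have "conditional_e_variable M ?F"
      unfolding conditional_e_variable_def
    proof (intro ballI conjI)
      fix Q assume Q: "Q \<in> prob_measures M"
      show "?F Q \<in> borel_measurable M"
        using E_meas I_sub[of Q] by (intro borel_measurable_prod_ennreal) auto
      show "(\<integral>\<^sup>+\<omega>. ?F Q \<omega> \<partial>Q) \<le> 1"
        using Q seq I_sub[of Q] finite_subset
        by (intro nn_integral_prod_sequential_le_1) (auto simp: prob_measures_def I_def)
    qed
    moreover have "algorithm2 K (\<lambda>j. E j \<omega>) k \<le> ?F Q \<omega>" if "k \<in> {1..K}" "Q \<in> H k" for k Q \<omega>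
      using that I_sub[of Q] by (intro algorithm2_le_prod) (auto simp: I_def)
    ultimately show ?thesis
      unfolding family_wise_valid_def by blast
  qed
qed

end
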